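(* Let $\pi_j:A_j\to\mathbb{R}^n$ ($j=1,2$) be unramified real domains over $\mathbb{R}^n$, and let $\mathfrak D=A_1+iA_2$ be the generalized tube, i.e. the domain $A_1\times A_2$ over $\mathbb{C}^n$ with projection $\pi(x+iy)=\pi_1(x)+i\pi_2(y)$. If $\mathfrak D$ is pseudoconvex, then both $\pi_1$ and $\pi_2$ are injective, and $\pi_1(A_1)$, $\pi_2(A_2)$ are convex subdomains of $\mathbb{R}^n$.
   Context: An unramified real domain over $\mathbb{R}^n$ is a connected Hausdorff space $A$ with a local homeomorphism $\pi_A:A\to\mathbb{R}^n$; it is univalent if $\pi_A$ is injective. A domain over $\mathbb{C}^n$ is a connected Hausdorff space $\mathfrak D$ with a local homeomorphism $\pi:\mathfrak D\to\mathbb{C}^n$, with the induced complex structure. For $\zeta\in\mathfrak D$, the boundary distance $\delta(\zeta,\partial\mathfrak D)$ is the supremum of $r>0$ such that the connected component of $\pi^{-1}(B(\pi(\zeta);r))$ containing $\zeta$ is mapped biholomorphically onto the Euclidean ball $B(\pi(\zeta);r)$ by $\pi$. $\mathfrak D$ is pseudoconvex if $-\log\delta(\zeta,\partial\mathfrak D)$ is a (continuous) plurisubharmonic function on $\mathfrak D$ (by Oka's theorem this holds in particular for domains of holomorphy). *)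

theory Defs
  imports "HOL-Analysis.Analysis"
begin

definition local_homeo :: "'a topology \<Rightarrow> ('a \<Rightarrow> 'b::topological_space) \<Rightarrow> bool" where
  "local_homeo X f \<longleftrightarrow>
     (\<forall>x\<in>topspace X. \<exists>U V. openin X U \<and> x \<in> U \<and> open V \<and>
        homeomorphic_map (subtopology X U) (subtopology euclidean V) f)"

definition domain_over :: "'a topology \<Rightarrow> ('a \<Rightarrow> 'b::topological_space) \<Rightarrow> bool" where
  "domain_over X f \<longleftrightarrow> topspace X \<noteq> {} \<and> connected_space X \<and> Hausdorff_space X \<and> local_homeo X f"

definition tube_proj :: "('a \<Rightarrow> real^'n) \<Rightarrow> ('b \<Rightarrow> real^'n) \<Rightarrow> ('a \<times> 'b) \<Rightarrow> complex^'n" where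
  "tube_proj p1 p2 = (\<lambda>(x, y). \<chi> i. Complex (p1 x $ i) (p2 y $ i))"

text \<open>Boundary distance (possibly infinite): supremum of r > 0 such that the connected
  component of the preimage of B(pi zeta, r) containing zeta is mapped biholomorphically
  (equivalently, since pi is locally biholomorphic, homeomorphically) onto the ball.\<close>
definition bdist :: "'a topology \<Rightarrow> ('a \<Rightarrow> complex^'n) \<Rightarrow> 'a \<Rightarrow> ereal" where
  "bdist D p z = Sup (ereal ` {r. r > 0 \<and>
      homeomorphic_map
        (subtopology D (connected_component_of_set
            (subtopology D {w \<in> topspace D. p w \<in> ball (p z) r}) z))
        (subtopology euclidean (ball (p z) r)) p})"

definition psh_on :: "(complex^'n) set \<Rightarrow> (complex^'n \<Rightarrow> real) \<Rightarrow> bool" where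
  "psh_on V f \<longleftrightarrow> continuous_on V f \<and>
     (\<forall>a b. (\<forall>l. cmod l \<le> 1 \<longrightarrow> a + l *s b \<in> V) \<longrightarrow>
        f a \<le> integral {0..2*pi} (\<lambda>t. f (a + exp (\<i> * complex_of_real t) *s b)) / (2*pi))"

definition psh_on_domain :: "'a topology \<Rightarrow> ('a \<Rightarrow> complex^'n) \<Rightarrow> ('a \<Rightarrow> real) \<Rightarrow> bool" where
  "psh_on_domain D p u \<longleftrightarrow> continuous_map D euclideanreal u \<and>
     (\<forall>W V g. openin D W \<and> open V \<and>
        homeomorphic_maps (subtopology D W) (subtopology euclidean V) p g \<longrightarrow>
        psh_on V (u \<circ> g))"

text \<open>Pseudoconvexity: -log delta is (continuous) plurisubharmonic. The case delta = +infinity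
  everywhere (D is C^n itself) is counted as pseudoconvex (-log delta = -infinity identically).\<close>
definition pseudoconvex :: "'a topology \<Rightarrow> ('a \<Rightarrow> complex^'n) \<Rightarrow> bool" where
  "pseudoconvex D p \<longleftrightarrow>
     (\<forall>z\<in>topspace D. bdist D p z = \<infinity>) \<or>
     ((\<forall>z\<in>topspace D. bdist D p z < \<infinity>) \<and>
      psh_on_domain D p (\<lambda>z. - ln (real_of_ereal (bdist D p z))))"

end

theory Submission
  imports Defs
begin

text \<open>
  Since the boundary distance \<open>\<delta>\<close> of the tube is the minimum of those of the factors, it satisfies
  \<open>\<delta>(x, y) \<ge> min (\<delta>(x, y0)) (\<delta>(x0, y))\<close>. Given a segment lifted to \<open>A1\<close>, complexify it at \<open>y0\<close>:
  near an interior maximum of \<open>- ln \<delta>(\<cdot>, y0)\<close> along it, this inequality bounds \<open>- ln \<delta>\<close> on a small complex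
  disc by that maximum, so the sub-mean value inequality moves the maximum to an endpoint. Hence \<open>\<delta>\<close>
  along a lifted segment is at least its minimum at the two ends. Therefore segments issuing from a fixed
  point can be lifted to end at any point of \<open>A1\<close> (the set of attained endpoints is clopen), which
  gives convexity of the image, and injectivity because a constant segment lifts only to a constant.
  The factor \<open>A2\<close> is treated in the same way, in the directions multiplied by \<open>\<i>\<close>.
\<close>

section \<open>Sections over balls and the boundary distance\<close>

lemma local_homeo_chart:
  fixes p :: "'a \<Rightarrow> 'b::topological_space"
  assumes "local_homeo X p" "x \<in> topspace X"
  obtains U V g where "openin X U" "x \<in> U" "open V"
    "homeomorphic_maps (subtopology X U) (top_of_set V) p g"
  using assms unfolding local_homeo_def homeomorphic_map_maps by meson

lemma chart_maps:
  fixes p :: "'a \<Rightarrow> 'b::topological_space"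
  assumes "homeomorphic_maps (subtopology X U) (top_of_set V) p g" "openin X U" "open V"
  shows "\<And>w. w \<in> U \<Longrightarrow> p w \<in> V" "\<And>w. w \<in> U \<Longrightarrow> g (p w) = w"
    "\<And>v. v \<in> V \<Longrightarrow> g v \<in> U" "\<And>v. v \<in> V \<Longrightarrow> p (g v) = v"
    "continuous_map (subtopology X U) euclidean p" "continuous_map (top_of_set V) X g"
proof -
  have U: "topspace (subtopology X U) = U"
    using assms(2) openin_subset by fastforce
  show "\<And>w. w \<in> U \<Longrightarrow> p w \<in> V" "\<And>w. w \<in> U \<Longrightarrow> g (p w) = w"
    "\<And>v. v \<in> V \<Longrightarrow> g v \<in> U" "\<And>v. v \<in> V \<Longrightarrow> p (g v) = v"
    "continuous_map (subtopology X U) euclidean p" "continuous_map (top_of_set V) X g"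
    using assms(1) U unfolding homeomorphic_maps_def continuous_map_in_subtopology
    by (auto simp: Pi_iff)
qed

lemma local_homeo_imp_continuous_map:
  fixes p :: "'a \<Rightarrow> 'b::topological_space"
  assumes "local_homeo X p"
  shows "continuous_map X euclidean p"
  unfolding continuous_map_def
proof (intro conjI allI impI)
  fix O' :: "'b set" assume O': "openin euclidean O'"
  show "openin X {x \<in> topspace X. p x \<in> O'}"
  proof (subst openin_subopen, intro ballI)
    fix x assume x: "x \<in> {x \<in> topspace X. p x \<in> O'}"
    then obtain U V g where c: "openin X U" "x \<in> U" "open V"
      "homeomorphic_maps (subtopology X U) (top_of_set V) p g"
      using local_homeo_chart[OF assms, of x] by auto
    note m = chart_maps[OF c(4,1,3)]
    have "openin (subtopology X U) {w \<in> topspace (subtopology X U). p w \<in> O'}"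
      using m(5) O' by (rule openin_continuous_map_preimage)
    then have "openin X {w \<in> topspace (subtopology X U). p w \<in> O'}"
      using c(1) openin_trans_full by blast
    then show "\<exists>T. openin X T \<and> x \<in> T \<and> T \<subseteq> {x \<in> topspace X. p x \<in> O'}"
      using x c(2) by (intro exI[of _ "{w \<in> topspace (subtopology X U). p w \<in> O'}"]) auto
  qed
qed auto

text \<open>The coincidence set is closed because \<open>X\<close> is Hausdorff and open because
  \<open>p\<close> is injective on every chart; connectedness of \<open>T\<close> does the
  rest.\<close>

lemma lift_unique:
  fixes p :: "'a \<Rightarrow> 'b::topological_space"
  assumes "local_homeo X p" "Hausdorff_space X" "connected_space T"
    and f: "continuous_map T X f" and g: "continuous_map T X g"
    and pfg: "\<And>t. t \<in> topspace T \<Longrightarrow> p (f t) = p (g t)"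
    and t0: "t0 \<in> topspace T" "f t0 = g t0" and t: "t \<in> topspace T"
  shows "f t = g t"
proof -
  let ?E = "{t \<in> topspace T. f t = g t}"
  have "closedin T ?E"
    by (rule closedin_continuous_maps_eq[OF assms(2) f g])
  moreover have "openin T ?E"
  proof (subst openin_subopen, intro ballI)
    fix s assume s: "s \<in> ?E"
    then have "f s \<in> topspace X" using f unfolding continuous_map_def by blast
    then obtain U V h where c: "openin X U" "f s \<in> U" "open V"
      "homeomorphic_maps (subtopology X U) (top_of_set V) p h"
      using local_homeo_chart[OF assms(1), of "f s"] by auto
    note m = chart_maps[OF c(4,1,3)]
    let ?N = "{t \<in> topspace T. f t \<in> U} \<inter> {t \<in> topspace T. g t \<in> U}"
    have "openin T ?N"
      using f g c(1) by (intro openin_Int openin_continuous_map_preimage) auto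
    moreover have "s \<in> ?N" using s c(2) by auto
    moreover have "?N \<subseteq> ?E"
    proof
      fix t assume t: "t \<in> ?N"
      then have "h (p (f t)) = f t" "h (p (g t)) = g t" "t \<in> topspace T" using m(2) by auto
      then have "f t = g t" using pfg by metis
      then show "t \<in> ?E" using t by simp
    qed
    ultimately show "\<exists>N. openin T N \<and> s \<in> N \<and> N \<subseteq> ?E" by blast
  qed
  ultimately have "?E = {} \<or> ?E = topspace T"
    using assms(3) unfolding connected_space_clopen_in by blast
  then show ?thesis using t0 t by blast
qed

text \<open>If a point \<open>v\<close> of a chart \<open>U\<close> satisfies
  \<open>\<sigma> (p v) \<in> U\<close>, then \<open>v\<close> and \<open>\<sigma> (p v)\<close>
  have the same projection, and injectivity of \<open>p\<close> on \<open>U\<close> forces them to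
  be equal. Such points \<open>v\<close> fill a neighbourhood of each point of the image.\<close>

lemma openin_section_image:
  fixes p :: "'a \<Rightarrow> 'b::topological_space"
  assumes "local_homeo X p" "open B" and \<sigma>: "continuous_map (top_of_set B) X \<sigma>"
    and p\<sigma>: "\<And>a. a \<in> B \<Longrightarrow> p (\<sigma> a) = a"
  shows "openin X (\<sigma> ` B)"
proof (subst openin_subopen, intro ballI)
  fix w assume "w \<in> \<sigma> ` B"
  then obtain a where a: "a \<in> B" "w = \<sigma> a" by auto
  then have "w \<in> topspace X" using \<sigma> by (auto simp: continuous_map_def)
  then obtain U V h where c: "openin X U" "w \<in> U" "open V"
    "homeomorphic_maps (subtopology X U) (top_of_set V) p h"
    using local_homeo_chart[OF assms(1), of w] by auto
  note m = chart_maps[OF c(4,1,3)]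
  let ?B = "{a \<in> topspace (top_of_set B). \<sigma> a \<in> U}"
  have "openin (top_of_set B) ?B"
    using \<sigma> c(1) by (rule openin_continuous_map_preimage)
  then have "open ?B" using assms(2) openin_open_trans by blast
  let ?N = "U \<inter> {w \<in> topspace X. p w \<in> ?B}"
  have "openin X ?N"
    using local_homeo_imp_continuous_map[OF assms(1)] \<open>open ?B\<close> c(1)
    by (intro openin_Int openin_continuous_map_preimage[where Y = euclidean]) auto
  moreover have "w \<in> ?N" using a c(2) p\<sigma> \<open>w \<in> topspace X\<close> by auto
  moreover have "?N \<subseteq> \<sigma> ` B"
  proof
    fix v assume v: "v \<in> ?N"
    then have "\<sigma> (p v) = v" using m(2)[of v] m(2)[of "\<sigma> (p v)"] p\<sigma>[of "p v"] by auto
    then show "v \<in> \<sigma> ` B" using v by force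
  qed
  ultimately show "\<exists>T. openin X T \<and> w \<in> T \<and> T \<subseteq> \<sigma> ` B" by blast
qed

text \<open>Replaces the component in \<open>bdist\<close> by a map that can be restricted, compared
  with other sections and paired across a product. For \<open>r \<le> 0\<close> the ball is empty
  and only the value at the centre is prescribed, so restricting to smaller radii requires no sign
  condition.\<close>

definition ball_section ::
  "'a topology \<Rightarrow> ('a \<Rightarrow> 'b::real_normed_vector) \<Rightarrow> 'a \<Rightarrow> real \<Rightarrow> ('b \<Rightarrow> 'a) \<Rightarrow> bool" where
  "ball_section X p x r \<sigma> \<longleftrightarrow> continuous_map (top_of_set (ball (p x) r)) X \<sigma> \<and>
     (\<forall>a\<in>ball (p x) r. p (\<sigma> a) = a) \<and> \<sigma> (p x) = x"

lemma ball_section_mono: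
  assumes "ball_section X p x r \<sigma>" "s \<le> r"
  shows "ball_section X p x s \<sigma>"
  using assms unfolding ball_section_def
  by (meson continuous_map_from_subtopology_mono subset_ball subsetD)

lemma ball_section_exists:
  fixes p :: "'a \<Rightarrow> 'b::real_normed_vector"
  assumes "local_homeo X p" "x \<in> topspace X"
  obtains r \<sigma> where "r > 0" "ball_section X p x r \<sigma>"
proof -
  obtain U V g where c: "openin X U" "x \<in> U" "open V"
    "homeomorphic_maps (subtopology X U) (top_of_set V) p g"
    using local_homeo_chart[OF assms] by auto
  note m = chart_maps[OF c(4,1,3)]
  obtain r where r: "r > 0" "ball (p x) r \<subseteq> V"
    using c(3) m(1)[OF c(2)] openE by blast
  have "ball_section X p x r g"
    using r m c(2) unfolding ball_section_def
    by (meson continuous_map_from_subtopology_mono subsetD)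
  then show ?thesis using that r by blast
qed

text \<open>A ball section is a clopen sheet of the preimage of the ball, hence its component.\<close>

lemma homeomorphic_component_iff_ball_section:
  fixes p :: "'a \<Rightarrow> 'b::real_normed_vector"
  assumes "local_homeo X p" "Hausdorff_space X" "z \<in> topspace X" "r > 0"
  shows "homeomorphic_map
        (subtopology X (connected_component_of_set
            (subtopology X {w \<in> topspace X. p w \<in> ball (p z) r}) z))
        (top_of_set (ball (p z) r)) p \<longleftrightarrow> (\<exists>\<sigma>. ball_section X p z r \<sigma>)"
    (is "homeomorphic_map (subtopology X ?C) (top_of_set ?B) p \<longleftrightarrow> _")
proof -
  let ?P = "{w \<in> topspace X. p w \<in> ?B}"
  have zP: "z \<in> ?P" using assms by auto
  have P: "openin X ?P"
    using local_homeo_imp_continuous_map[OF assms(1)]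
    by (intro openin_continuous_map_preimage[where Y = euclidean]) auto
  have topP: "topspace (subtopology X ?P) = ?P" by auto
  have zC: "z \<in> ?C"
    using zP topP by (simp add: connected_component_of_refl)
  have CP: "?C \<subseteq> ?P"
    using connected_component_of_subset_topspace[of "subtopology X ?P" z] by auto
  then have topC: "topspace (subtopology X ?C) = ?C" by auto
  show ?thesis
  proof
    assume "homeomorphic_map (subtopology X ?C) (top_of_set ?B) p"
    then obtain g where "homeomorphic_maps (subtopology X ?C) (top_of_set ?B) p g"
      unfolding homeomorphic_map_maps by blast
    then have "ball_section X p z r g"
      using zC topC unfolding ball_section_def homeomorphic_maps_def continuous_map_in_subtopology
      by auto
    then show "\<exists>\<sigma>. ball_section X p z r \<sigma>" by blast
  next
    assume "\<exists>\<sigma>. ball_section X p z r \<sigma>"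
    then obtain \<sigma> where \<sigma>: "continuous_map (top_of_set ?B) X \<sigma>"
      "\<And>a. a \<in> ?B \<Longrightarrow> p (\<sigma> a) = a" "\<sigma> (p z) = z"
      unfolding ball_section_def by blast
    have \<sigma>X: "\<sigma> a \<in> topspace X" if "a \<in> ?B" for a
      using \<sigma>(1) that by (auto simp: continuous_map_def)
    have \<sigma>P: "\<sigma> ` ?B \<subseteq> ?P" using \<sigma>X \<sigma>(2) by auto
    have op: "openin (subtopology X ?P) (\<sigma> ` ?B)"
      using openin_section_image[OF assms(1) _ \<sigma>(1,2)] \<sigma>P
      by (metis P open_ball openin_open_subtopology)
    have pc: "continuous_map (subtopology X ?P) (top_of_set ?B) p"
      using continuous_map_from_subtopology[OF local_homeo_imp_continuous_map[OF assms(1)]]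
      by (auto intro!: continuous_map_into_subtopology)
    \<comment> \<open>The sheet is the equalizer of \<open>\<sigma> \<circ> p\<close> and the
      identity on \<open>?P\<close>, which is closed because \<open>X\<close> is Hausdorff.\<close>
    have "closedin (subtopology X ?P) {w \<in> topspace (subtopology X ?P). (\<sigma> \<circ> p) w = id w}"
      by (intro closedin_continuous_maps_eq[OF assms(2)] continuous_map_compose[OF pc \<sigma>(1)]) simp
    also have "{w \<in> topspace (subtopology X ?P). (\<sigma> \<circ> p) w = id w} = \<sigma> ` ?B"
      using \<sigma>P \<sigma>(2) unfolding topP by force
    finally have cl: "closedin (subtopology X ?P) (\<sigma> ` ?B)" .
    have con: "connectedin (subtopology X ?P) (\<sigma> ` ?B)"
    proof (rule connectedin_continuous_map_image)
      show "continuous_map (top_of_set ?B) (subtopology X ?P) \<sigma>"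
        using \<sigma>(1) by (rule continuous_map_into_subtopology) (use \<sigma>X \<sigma>(2) in auto)
      show "connectedin (top_of_set ?B) ?B"
        by (simp add: connectedin_subtopology)
    qed
    have zB: "z \<in> \<sigma> ` ?B" using \<sigma>(3) assms(4) by (intro image_eqI[of _ _ "p z"]) auto
    have "\<sigma> ` ?B \<subseteq> ?C"
      using con zB unfolding connected_component_of_def by blast
    moreover have "?C \<subseteq> \<sigma> ` ?B"
    proof
      fix w assume "w \<in> ?C"
      then obtain T where T: "connectedin (subtopology X ?P) T" "z \<in> T" "w \<in> T"
        unfolding connected_component_of_def by blast
      then have "T \<subseteq> \<sigma> ` ?B \<or> disjnt T (\<sigma> ` ?B)"
        using connectedin_clopen_cases[OF T(1) cl op] by blast
      then show "w \<in> \<sigma> ` ?B" using T zB unfolding disjnt_iff by blast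
    qed
    ultimately have C: "?C = \<sigma> ` ?B" by blast
    have "homeomorphic_maps (subtopology X (\<sigma> ` ?B)) (top_of_set ?B) p \<sigma>"
      unfolding homeomorphic_maps_def continuous_map_in_subtopology
      using \<sigma> local_homeo_imp_continuous_map[OF assms(1)]
      by (auto intro!: continuous_map_from_subtopology)
    then show "homeomorphic_map (subtopology X ?C) (top_of_set ?B) p"
      unfolding C homeomorphic_map_maps by blast
  qed
qed

text \<open>From here on the boundary distance is handled through sections, without reference to
  components.\<close>

lemma bdist_eq_Sup_ball_section:
  fixes p :: "'a \<Rightarrow> complex^'n"
  assumes "local_homeo X p" "Hausdorff_space X" "z \<in> topspace X"
  shows "bdist X p z = Sup (ereal ` {r. r > 0 \<and> (\<exists>\<sigma>. ball_section X p z r \<sigma>)})"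
proof -
  note iff = homeomorphic_component_iff_ball_section[OF assms]
  show ?thesis
    unfolding bdist_def
    by (rule arg_cong[where f = "\<lambda>R. Sup (ereal ` R)"], rule Collect_cong, rule conj_cong[OF refl], erule iff)
qed

lemma bdist_pos:
  fixes p :: "'a \<Rightarrow> complex^'n"
  assumes "local_homeo X p" "Hausdorff_space X" "z \<in> topspace X"
  shows "bdist X p z > 0"
proof -
  obtain r \<sigma> where "r > 0" "ball_section X p z r \<sigma>"
    using ball_section_exists[OF assms(1,3)] .
  then have "ereal r \<le> bdist X p z" 
    unfolding bdist_eq_Sup_ball_section[OF assms] by (intro Sup_upper) auto
  with \<open>r > 0\<close> show ?thesis by (metis ereal_less(2) order_less_le_trans)
qed

text \<open>The strict inequality yields a section of some larger radius, which is then restricted;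
  whether the supremum is attained never has to be decided.\<close>

lemma ball_section_less_bdist:
  fixes p :: "'a \<Rightarrow> complex^'n"
  assumes "local_homeo X p" "Hausdorff_space X" "z \<in> topspace X" "ereal r < bdist X p z"
  obtains \<sigma> where "ball_section X p z r \<sigma>"
proof -
  obtain s \<sigma> where "ball_section X p z s \<sigma>" "r < s"
    using assms(4) unfolding bdist_eq_Sup_ball_section[OF assms(1-3)] less_Sup_iff by auto
  then show ?thesis using that ball_section_mono[of X p z s \<sigma> r] by auto
qed

section \<open>Lifting segments\<close>

text \<open>Two balls meet in a convex, hence connected set, so unique lifting applies to the two
  sections over it.\<close>

lemma ball_section_agree:
  fixes p :: "'a \<Rightarrow> 'b::real_normed_vector"
  assumes "local_homeo X p" "Hausdorff_space X"
    and s: "ball_section X p x r \<sigma>" and s': "ball_section X p x' r' \<sigma>'"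
    and a: "a \<in> ball (p x) r \<inter> ball (p x') r'" "\<sigma> a = \<sigma>' a"
    and b: "b \<in> ball (p x) r \<inter> ball (p x') r'"
  shows "\<sigma> b = \<sigma>' b"
proof -
  let ?I = "ball (p x) r \<inter> ball (p x') r'"
  have "connected_space (top_of_set ?I)"
    by (simp add: convex_Int convex_connected flip: connectedin_def[of euclidean, simplified])
  moreover have "continuous_map (top_of_set ?I) X \<sigma>" "continuous_map (top_of_set ?I) X \<sigma>'"
    using s s' unfolding ball_section_def
    by (meson continuous_map_from_subtopology_mono inf_le1 inf_le2)+
  ultimately show ?thesis
    by (rule lift_unique[OF assms(1,2)])
      (use s s' a b in \<open>auto simp: ball_section_def\<close>)
qed

text \<open>Transports the lift \<open>\<gamma>\<close> to the nearby path \<open>q\<close> by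
  moving, at each time, inside the sheet of radius \<open>\<epsilon>\<close> about
  \<open>\<gamma> t\<close>. The sections \<open>\<tau> t\<close> are chosen independently for each
  \<open>t\<close>. Continuity holds because for \<open>t'\<close> near \<open>t\<close> the point
  \<open>\<gamma> t'\<close> lies in the sheet of \<open>\<tau> t\<close>, so that
  \<open>\<tau> t\<close> and \<open>\<tau> t'\<close> agree on the overlap of their balls.\<close>

lemma continuous_map_near_lift:
  fixes p :: "'a \<Rightarrow> 'b::real_normed_vector"
  assumes "local_homeo X p" "Hausdorff_space X"
    and \<gamma>: "continuous_map (top_of_set I) X \<gamma>"
    and \<tau>: "\<And>t. t \<in> I \<Longrightarrow> ball_section X p (\<gamma> t) \<epsilon> (\<tau> t)"
    and q: "continuous_on I q" "\<And>t. t \<in> I \<Longrightarrow> dist (p (\<gamma> t)) (q t) < \<epsilon>"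
  shows "continuous_map (top_of_set I) X (\<lambda>t. \<tau> t (q t))"
  unfolding continuous_map_def
proof (intro conjI allI impI)
  show "(\<lambda>t. \<tau> t (q t)) \<in> topspace (top_of_set I) \<rightarrow> topspace X"
    using \<tau> q(2) unfolding ball_section_def continuous_map_def by fastforce
  fix Q assume Q: "openin X Q"
  have pos: "\<epsilon> > 0" if "t \<in> I" for t
    using q(2)[OF that] zero_le_dist[of "p (\<gamma> t)" "q t"] by linarith
  show "openin (top_of_set I) {t \<in> topspace (top_of_set I). \<tau> t (q t) \<in> Q}"
  proof (subst openin_subopen, intro ballI)
    fix t assume "t \<in> {t \<in> topspace (top_of_set I). \<tau> t (q t) \<in> Q}"
    then have t: "t \<in> I" "\<tau> t (q t) \<in> Q" by auto
    let ?B = "ball (p (\<gamma> t)) \<epsilon>"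
    have s: "continuous_map (top_of_set ?B) X (\<tau> t)" "\<And>a. a \<in> ?B \<Longrightarrow> p (\<tau> t a) = a"
      "\<tau> t (p (\<gamma> t)) = \<gamma> t"
      using \<tau>[OF t(1)] unfolding ball_section_def by auto
    have W: "openin X (\<tau> t ` ?B)"
      by (rule openin_section_image[OF assms(1) _ s(1,2)]) auto
    let ?O = "{a \<in> topspace (top_of_set ?B). \<tau> t a \<in> Q}"
    have "openin (top_of_set ?B) ?O"
      using s(1) Q by (rule openin_continuous_map_preimage)
    then have O: "open ?O" using openin_open_trans open_ball by blast
    let ?N = "{t' \<in> topspace (top_of_set I). \<gamma> t' \<in> \<tau> t ` ?B} \<inter>
      {t' \<in> topspace (top_of_set I). q t' \<in> ?O}"
    have "openin (top_of_set I) ?N"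
      using \<gamma> W O q(1)
      by (intro openin_Int openin_continuous_map_preimage[OF \<gamma>]
            openin_continuous_map_preimage[where Y = euclidean]) auto
    moreover have "t \<in> ?N"
      using t q(2)[OF t(1)] s(3) pos[OF t(1)] by (auto intro!: image_eqI[of _ _ "p (\<gamma> t)"])
    moreover have "\<tau> t' (q t') \<in> Q" if t': "t' \<in> ?N" for t'
    proof -
      have "t' \<in> I" using t' by auto
      obtain a where a: "a \<in> ?B" "\<gamma> t' = \<tau> t a" using t' by blast
      have pa: "p (\<gamma> t') = a" using s(2) a by simp
      have s': "ball_section X p (\<gamma> t') \<epsilon> (\<tau> t')" by (rule \<tau>[OF \<open>t' \<in> I\<close>])
      have "\<tau> t (q t') = \<tau> t' (q t')"
      proof (rule ball_section_agree[OF assms(1,2) \<tau>[OF t(1)] s', of a])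
        show "\<tau> t a = \<tau> t' a" using s' a pa unfolding ball_section_def by simp
      qed (use a pa pos[OF t(1)] t' q(2)[OF \<open>t' \<in> I\<close>] in auto)
      then show ?thesis using t' by auto
    qed
    ultimately show "\<exists>T. openin (top_of_set I) T \<and> t \<in> T \<and>
        T \<subseteq> {t \<in> topspace (top_of_set I). \<tau> t (q t) \<in> Q}"
      by (intro exI[of _ ?N]) auto
  qed
qed

definition lifted_segment ::
  "'a topology \<Rightarrow> ('a \<Rightarrow> 'b::real_normed_vector) \<Rightarrow> 'a \<Rightarrow> 'a \<Rightarrow> (real \<Rightarrow> 'a) \<Rightarrow> bool" where
  "lifted_segment X p x y \<gamma> \<longleftrightarrow> continuous_map (top_of_set {0..1}) X \<gamma> \<and> \<gamma> 0 = x \<and> \<gamma> 1 = y \<and>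
     (\<forall>t\<in>{0..1}. p (\<gamma> t) = p x + t *\<^sub>R (p y - p x))"

text \<open>The hypothesis on \<open>d\<close> keeps sheets of uniform size along all segments ending near a given
  point, so the set of endpoints of lifted segments from a fixed origin is clopen.\<close>

lemma lifted_segment_exists:
  fixes p :: "'a \<Rightarrow> 'b::real_normed_vector" and d :: "'a \<Rightarrow> ereal"
  assumes dom: "domain_over X p"
    and sec: "\<And>x r. x \<in> topspace X \<Longrightarrow> ereal r < d x \<Longrightarrow> \<exists>\<sigma>. ball_section X p x r \<sigma>"
    and pos: "\<And>x. x \<in> topspace X \<Longrightarrow>
      \<exists>N \<epsilon>. openin X N \<and> x \<in> N \<and> \<epsilon> > 0 \<and> (\<forall>w\<in>N. ereal \<epsilon> < d w)"
    and seg: "\<And>x y \<gamma> t. lifted_segment X p x y \<gamma> \<Longrightarrow> t \<in> {0..1} \<Longrightarrow> min (d x) (d y) \<le> d (\<gamma> t)"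
    and x0: "x0 \<in> topspace X" and x1: "x1 \<in> topspace X"
  shows "\<exists>\<gamma>. lifted_segment X p x0 x1 \<gamma>"
proof -
  have lh: "local_homeo X p" and H: "Hausdorff_space X" and con: "connected_space X"
    using dom by (auto simp: domain_over_def)
  let ?S = "{x \<in> topspace X. \<exists>\<gamma>. lifted_segment X p x0 x \<gamma>}"
  have key: "\<exists>N. openin X N \<and> x \<in> N \<and> (\<forall>x'\<in>N. \<forall>x''\<in>N. x' \<in> ?S \<longrightarrow> x'' \<in> ?S)"
    if x: "x \<in> topspace X" for x
  proof -
    obtain \<epsilon>0 where \<epsilon>0: "\<epsilon>0 > 0" "ereal \<epsilon>0 < d x0" using pos[OF x0] by blast
    obtain N0 \<epsilon>1 where N0: "openin X N0" "x \<in> N0" "\<epsilon>1 > 0" "\<And>w. w \<in> N0 \<Longrightarrow> ereal \<epsilon>1 < d w"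
      using pos[OF x] by blast
    \<comment> \<open>A single radius below \<open>d\<close> at the origin \<open>x0\<close> and on
      all of \<open>N0\<close>. By \<open>seg\<close> it is then below \<open>d\<close> along every
      lifted segment from \<open>x0\<close> to a point of \<open>N0\<close>.\<close>
    define \<epsilon> where "\<epsilon> = min \<epsilon>0 \<epsilon>1"
    have \<epsilon>: "\<epsilon> > 0" "ereal \<epsilon> < d x0" "\<And>w. w \<in> N0 \<Longrightarrow> ereal \<epsilon> < d w"
      using \<epsilon>0 N0(3) le_less_trans[OF _ \<epsilon>0(2), of "ereal \<epsilon>"] le_less_trans[OF _ N0(4), of "ereal \<epsilon>"]
      by (auto simp: \<epsilon>_def)
    obtain \<sigma> where \<sigma>: "ball_section X p x \<epsilon> \<sigma>" using sec[OF x \<epsilon>(3)[OF N0(2)]] by blast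
    \<comment> \<open>Halving the radius keeps the projections of any two points of
      \<open>?W\<close> less than \<open>\<epsilon>\<close> apart.\<close>
    then have \<sigma>2: "ball_section X p x (\<epsilon>/2) \<sigma>" using ball_section_mono \<epsilon>(1) by fastforce
    let ?W = "\<sigma> ` ball (p x) (\<epsilon>/2)"
    have W: "openin X ?W"
      by (rule openin_section_image[OF lh]) (use \<sigma>2 in \<open>auto simp: ball_section_def\<close>)
    have "x \<in> ?W"
      using \<sigma> \<epsilon>(1) by (auto simp: ball_section_def intro!: image_eqI[of _ _ "p x"])
    moreover have "x'' \<in> ?S" if nb: "x' \<in> N0 \<inter> ?W" "x'' \<in> N0 \<inter> ?W" "x' \<in> ?S" for x' x''
    proof -
      obtain \<gamma> where \<gamma>: "lifted_segment X p x0 x' \<gamma>" using nb(3) by blast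
      have p': "p x' \<in> ball (p x) (\<epsilon>/2)" "\<sigma> (p x') = x'"
        "p x'' \<in> ball (p x) (\<epsilon>/2)" "\<sigma> (p x'') = x''"
        using nb(1,2) \<sigma>2 by (auto simp: ball_section_def)
      have dist: "dist (p x') (p x'') < \<epsilon>"
        using p'(1,3) dist_triangle_half_r[of "p x" "p x'" \<epsilon> "p x''"] by simp
      have "\<exists>\<tau>. ball_section X p (\<gamma> t) \<epsilon> \<tau>" if t: "t \<in> {0..1}" for t
      proof (rule sec)
        show "\<gamma> t \<in> topspace X"
          using \<gamma> t unfolding lifted_segment_def continuous_map_def by auto
        have "ereal \<epsilon> < min (d x0) (d x')" using \<epsilon> \<open>x' \<in> N0 \<inter> ?W\<close> by simp
        then show "ereal \<epsilon> < d (\<gamma> t)" using seg[OF \<gamma> t] by (rule less_le_trans)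
      qed
      then obtain \<tau> where \<tau>: "\<And>t. t \<in> {0..1} \<Longrightarrow> ball_section X p (\<gamma> t) \<epsilon> (\<tau> t)" by metis
      define q where "q t = p x0 + t *\<^sub>R (p x'' - p x0)" for t
      have p\<gamma>: "p (\<gamma> t) = p x0 + t *\<^sub>R (p x' - p x0)" if "t \<in> {0..1}" for t
        using \<gamma> that by (auto simp: lifted_segment_def)
      have dq: "dist (p (\<gamma> t)) (q t) < \<epsilon>" if t: "t \<in> {0..1}" for t
      proof -
        have "p (\<gamma> t) - q t = t *\<^sub>R (p x' - p x'')"
          unfolding p\<gamma>[OF t] q_def by (simp add: algebra_simps)
        then have "dist (p (\<gamma> t)) (q t) = t * dist (p x') (p x'')"
          using t by (simp add: dist_norm)
        also have "\<dots> \<le> dist (p x') (p x'')"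
          using t by (simp add: mult_left_le_one_le)
        finally show ?thesis using dist by simp
      qed
      have "continuous_map (top_of_set {0..1}) X (\<lambda>t. \<tau> t (q t))"
        by (rule continuous_map_near_lift[OF lh H _ \<tau> _ dq])
          (use \<gamma> in \<open>auto simp: lifted_segment_def q_def intro!: continuous_intros\<close>)
      moreover have "\<tau> 0 (q 0) = x0"
        using \<tau>[of 0] \<gamma> by (simp add: q_def ball_section_def lifted_segment_def)
      \<comment> \<open>The transported path ends at \<open>x''\<close> itself and not merely at
        some point over \<open>p x''\<close>: the section \<open>\<tau> 1\<close> about
        \<open>x'\<close> and the section \<open>\<sigma>\<close> about \<open>x\<close> agree at
        \<open>p x'\<close>, hence also at \<open>p x''\<close>.\<close>
      moreover have "\<tau> 1 (q 1) = x''"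
      proof -
        have \<gamma>1: "\<gamma> 1 = x'" using \<gamma> by (simp add: lifted_segment_def)
        have \<tau>1: "ball_section X p x' \<epsilon> (\<tau> 1)" using \<tau>[of 1] \<gamma>1 by simp
        have "\<tau> 1 (p x'') = \<sigma> (p x'')"
          by (rule ball_section_agree[OF lh H \<tau>1 \<sigma>2, of "p x'"])
            (use p' \<tau>1 dist \<epsilon>(1) in \<open>auto simp: ball_section_def\<close>)
        then show ?thesis using p' by (simp add: q_def)
      qed
      moreover have "p (\<tau> t (q t)) = q t" if "t \<in> {0..1}" for t
        using \<tau>[OF that] dq[OF that] by (auto simp: ball_section_def)
      ultimately have "lifted_segment X p x0 x'' (\<lambda>t. \<tau> t (q t))"
        by (simp add: lifted_segment_def q_def)
      moreover have "x'' \<in> topspace X" using nb(2) W openin_subset by blast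
      ultimately show ?thesis by blast
    qed
    moreover have "openin X (N0 \<inter> ?W)" using N0(1) W by (rule openin_Int)
    ultimately show ?thesis using N0(2) by (intro exI[of _ "N0 \<inter> ?W"]) blast
  qed
  have "openin X ?S"
  proof (subst openin_subopen, intro ballI)
    fix x assume "x \<in> ?S"
    then show "\<exists>T. openin X T \<and> x \<in> T \<and> T \<subseteq> ?S" using key[of x] by blast
  qed
  \<comment> \<open>The neighbourhoods in \<open>key\<close> treat \<open>x'\<close> and
    \<open>x''\<close> symmetrically: one reachable point makes all points of \<open>N\<close>
    reachable, so one unreachable point makes all of them unreachable.\<close>
  moreover have "openin X (topspace X - ?S)"
  proof (subst openin_subopen, intro ballI)
    fix x assume x: "x \<in> topspace X - ?S"
    then obtain N where "openin X N" "x \<in> N" "\<forall>x'\<in>N. \<forall>x''\<in>N. x' \<in> ?S \<longrightarrow> x'' \<in> ?S"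
      using key[of x] by blast
    with x show "\<exists>T. openin X T \<and> x \<in> T \<and> T \<subseteq> topspace X - ?S"
      using openin_subset[of X N] by (intro exI[of _ N]) blast
  qed
  then have "closedin X ?S" by (auto simp: closedin_def)
  ultimately have "?S = {} \<or> ?S = topspace X"
    using con unfolding connected_space_clopen_in by blast
  moreover have "lifted_segment X p x0 x0 (\<lambda>t. x0)" using x0 by (simp add: lifted_segment_def)
  ultimately show ?thesis using x0 x1 by blast
qed

section \<open>From lifted segments to injectivity and convexity\<close>

lemma inj_on_convex_if_lifted_segments:
  fixes p :: "'a \<Rightarrow> 'b::real_normed_vector"
  assumes lh: "local_homeo X p" and H: "Hausdorff_space X"
    and ex: "\<And>x y. x \<in> topspace X \<Longrightarrow> y \<in> topspace X \<Longrightarrow> \<exists>\<gamma>. lifted_segment X p x y \<gamma>"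
  shows "inj_on p (topspace X)" "convex (p ` topspace X)"
proof -
  show "inj_on p (topspace X)"
  proof (rule inj_onI)
    fix x y assume xy: "x \<in> topspace X" "y \<in> topspace X" "p x = p y"
    obtain \<gamma> where \<gamma>: "lifted_segment X p x y \<gamma>" using ex xy by blast
    have "connected_space (top_of_set {0..1::real})"
      by (simp flip: connectedin_def[of euclidean, simplified])
    moreover have \<gamma>': "continuous_map (top_of_set {0..1}) X \<gamma>" "\<gamma> 0 = x" "\<gamma> 1 = y"
      and "\<And>t. t \<in> {0..1} \<Longrightarrow> p (\<gamma> t) = p x"
      using \<gamma> \<open>p x = p y\<close> unfolding lifted_segment_def by auto
    ultimately have "\<gamma> 1 = (\<lambda>_. x) 1"
      using xy(1) by - (rule lift_unique[OF lh H, of "top_of_set {0..1}" \<gamma> "\<lambda>_. x" 0], auto)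
    then show "x = y" using \<gamma>'(3) by simp
  qed
  show "convex (p ` topspace X)"
    unfolding convex_alt
  proof clarify
    fix x y and u :: real
    assume xy: "x \<in> topspace X" "y \<in> topspace X" and u: "0 \<le> u" "u \<le> 1"
    obtain \<gamma> where \<gamma>: "lifted_segment X p x y \<gamma>" using ex xy by blast
    have "\<gamma> u \<in> topspace X"
      using \<gamma> u by (auto simp: lifted_segment_def continuous_map_def)
    moreover have "(1 - u) *\<^sub>R p x + u *\<^sub>R p y = p (\<gamma> u)"
      using \<gamma> u by (simp add: lifted_segment_def algebra_simps)
    ultimately show "(1 - u) *\<^sub>R p x + u *\<^sub>R p y \<in> p ` topspace X" by (metis imageI)
  qed
qed

section \<open>Maximum principle\<close>

text \<open>The hypothesis \<open>u\<Gamma>\<close> compares a point of the strip with its foot on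
  the real segment and with the point at the same height over \<open>t = 0\<close>. The foot never
  exceeds the maximum \<open>M\<close> along the segment. If the endpoint values are below
  \<open>M\<close>, then so is the value over \<open>t = 0\<close> at small heights. Hence
  \<open>M\<close> bounds \<open>u\<close> on a full complex disc about an interior maximum
  point.\<close>

lemma psh_maximum_principle:
  fixes P :: "'a \<Rightarrow> complex^'n"
  assumes lh: "local_homeo D P" and psh: "psh_on_domain D P u" and e: "e > 0"
    and \<Gamma>: "continuous_map (top_of_set ({0..1} \<times> {-e<..<e})) D \<Gamma>"
    and P\<Gamma>: "\<And>t s. t \<in> {0..1} \<Longrightarrow> s \<in> {-e<..<e} \<Longrightarrow> P (\<Gamma> (t, s)) = \<alpha> + Complex t s *s \<beta>"
    and u\<Gamma>: "\<And>t s. t \<in> {0..1} \<Longrightarrow> s \<in> {-e<..<e} \<Longrightarrow>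
      u (\<Gamma> (t, s)) \<le> max (u (\<Gamma> (t, 0))) (u (\<Gamma> (0, s)))"
    and t: "t \<in> {0..1}"
  shows "u (\<Gamma> (t, 0)) \<le> max (u (\<Gamma> (0, 0))) (u (\<Gamma> (1, 0)))"
proof (rule ccontr)
  assume neg: "\<not> ?thesis"
  let ?R = "{0..1} \<times> {-e<..<e}"
  have uc: "continuous_map D euclideanreal u"
    using psh by (simp add: psh_on_domain_def)
  have u\<Gamma>c: "continuous_on ?R (\<lambda>x. u (\<Gamma> x))"
    using continuous_map_compose[OF \<Gamma> uc] by (simp add: o_def)
  define v where "v t = u (\<Gamma> (t, 0))" for t
  have vc: "continuous_on {0..1} v"
    unfolding v_def by (rule continuous_on_compose2[OF u\<Gamma>c]) (use e in \<open>auto intro!: continuous_intros\<close>)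
  obtain tm where tm: "tm \<in> {0..1}" "\<And>s. s \<in> {0..1} \<Longrightarrow> v s \<le> v tm"
    using continuous_attains_sup[OF _ _ vc] by fastforce
  define M where "M = v tm"
  have M: "v 0 < M" "v 1 < M"
    using neg tm(2)[OF t] by (auto simp: v_def M_def)
  \<comment> \<open>The leftmost maximum point is chosen so that the value \<open>M\<close> is not
    taken anywhere to its left.\<close>
  define K where "K = {0..1} \<inter> v -` {M}"
  have "closed K"
    unfolding K_def by (rule continuous_closed_preimage[OF vc]) auto
  moreover have K: "K \<noteq> {}" "bdd_below K"
    using tm(1) by (auto simp: K_def M_def intro: bdd_belowI[of _ 0])
  ultimately have "Inf K \<in> K" by (rule closed_contains_Inf[rotated 2])
  moreover define ts where "ts = Inf K"
  ultimately have ts: "ts \<in> {0..1}" "v ts = M" by (auto simp: K_def)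
  have "ts \<noteq> 0" "ts \<noteq> 1" using ts(2) M by auto
  with ts have ts01: "0 < ts" "ts < 1" by auto
  have before: "v s \<noteq> M" if "0 \<le> s" "s < ts" for s
  proof
    assume "v s = M"
    then have "s \<in> K" using that ts01 by (auto simp: K_def)
    then have "ts \<le> s" unfolding ts_def using K(2) by (rule cInf_lower)
    then show False using that by simp
  qed
  have tsR: "(ts, 0) \<in> ?R" using ts01 e by auto
  then have "\<Gamma> (ts, 0) \<in> topspace D" using \<Gamma> by (auto simp: continuous_map_def)
  then obtain W V g where c: "openin D W" "\<Gamma> (ts, 0) \<in> W" "open V"
    "homeomorphic_maps (subtopology D W) (top_of_set V) P g"
    using local_homeo_chart[OF lh] by metis
  note m = chart_maps[OF c(4,1,3)]
  have "openin (top_of_set ?R) {x \<in> topspace (top_of_set ?R). \<Gamma> x \<in> W}"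
    using \<Gamma> c(1) by (rule openin_continuous_map_preimage)
  then obtain T where T: "open T" "{x \<in> ?R. \<Gamma> x \<in> W} = ?R \<inter> T"
    by (auto simp: openin_open)
  \<comment> \<open>The set \<open>?S\<close> of heights at which the value over
    \<open>t = 0\<close> stays below \<open>M\<close> is an open neighbourhood of \<open>0\<close>,
    since \<open>v 0 < M\<close>.\<close>
  have "continuous_on {-e<..<e} (\<lambda>s. u (\<Gamma> (0, s)))"
    by (rule continuous_on_compose2[OF u\<Gamma>c]) (auto intro!: continuous_intros)
  then have "openin (top_of_set {-e<..<e}) ({-e<..<e} \<inter> (\<lambda>s. u (\<Gamma> (0, s))) -` {..<M})"
    by (rule continuous_openin_preimage_gen) auto
  then have S: "open ({-e<..<e} \<inter> (\<lambda>s. u (\<Gamma> (0, s))) -` {..<M})" (is "open ?S")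
    using openin_open_trans open_greaterThanLessThan by blast
  \<comment> \<open>The factor \<open>T\<close> keeps the disc inside the chart \<open>W\<close>,
    the interval keeps its feet on the segment, and \<open>?S\<close> keeps the second term of
    \<open>u\<Gamma>\<close> below \<open>M\<close>.\<close>
  have "open (T \<inter> ({0<..<1} \<times> ?S))" by (rule open_Int[OF T(1) open_Times[OF open_greaterThanLessThan S]])
  moreover have "(ts, 0) \<in> T" using T(2) tsR c(2) by blast
  then have "(ts, 0) \<in> T \<inter> ({0<..<1} \<times> ?S)" using ts01 e M by (auto simp: v_def)
  ultimately obtain h where h: "h > 0" "cball (ts, 0) h \<subseteq> T \<inter> ({0<..<1} \<times> ?S)"
    by (meson open_contains_cball)
  text \<open>On the circle of radius \<open>h\<close> about the first maximum point \<open>ts\<close> the function is at most \<open>M\<close>, and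
    less than \<open>M\<close> at \<open>ts - h\<close>, contradicting the sub-mean value inequality.\<close>
  define a where "a = \<alpha> + Complex ts 0 *s \<beta>"
  define b where "b = complex_of_real h *s \<beta>"
  \<comment> \<open>Rescales the disc of radius \<open>h\<close> about \<open>(ts, 0)\<close> to the
    closed unit disc that occurs in \<open>psh_on\<close>; by \<open>GW\<close> and
    \<open>PG\<close>, \<open>G l\<close> is the value of the local inverse \<open>g\<close> at
    \<open>a + l *s b\<close>.\<close>
  define G where "G l = \<Gamma> (ts + h * Re l, h * Im l)" for l
  have inT: "ts + h * Re l \<in> {0<..<1}" "h * Im l \<in> ?S" "(ts + h * Re l, h * Im l) \<in> T"
    if l: "cmod l \<le> 1" for l
  proof -
    have "dist (ts, 0) (ts + h * Re l, h * Im l) = sqrt ((h * Re l)\<^sup>2 + (h * Im l)\<^sup>2)"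
      by (simp add: dist_Pair_Pair dist_real_def)
    also have "\<dots> = h * cmod l"
      using h(1) by (simp add: cmod_def power_mult_distrib real_sqrt_mult flip: distrib_left)
    also have "\<dots> \<le> h" using h(1) l by simp
    finally have "(ts + h * Re l, h * Im l) \<in> cball (ts, 0) h" by simp
    then show "ts + h * Re l \<in> {0<..<1}" "h * Im l \<in> ?S" "(ts + h * Re l, h * Im l) \<in> T"
      using h(2) by blast+
  qed
  have GW: "G l \<in> W" if l: "cmod l \<le> 1" for l
    using inT[OF l] T(2) unfolding G_def by force
  have PG: "P (G l) = a + l *s b" if l: "cmod l \<le> 1" for l
  proof -
    have "P (G l) = \<alpha> + Complex (ts + h * Re l) (h * Im l) *s \<beta>"
      unfolding G_def by (rule P\<Gamma>) (use inT[OF l] in auto)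
    also have "Complex (ts + h * Re l) (h * Im l) = Complex ts 0 + l * of_real h"
      by (simp add: complex_eq_iff)
    finally show ?thesis unfolding a_def b_def by (simp add: vec_eq_iff algebra_simps)
  qed
  have V: "a + l *s b \<in> V" "g (a + l *s b) = G l" if l: "cmod l \<le> 1" for l
    using m(1,2)[OF GW[OF l]] PG[OF l] by auto
  have pV: "psh_on V (u \<circ> g)"
    using psh c by (auto simp: psh_on_domain_def)
  have g0: "g a = \<Gamma> (ts, 0)" using V(2)[of 0] by (simp add: G_def)
  define f where "f \<theta> = (u \<circ> g) (a + exp (\<i> * complex_of_real \<theta>) *s b)" for \<theta>
  have ugc: "continuous_on V (u \<circ> g)" using pV by (simp add: psh_on_def)
  have fc: "continuous_on {0..2*pi} f"
    unfolding f_def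
  proof (rule continuous_on_compose2[OF ugc])
    show "continuous_on {0..2*pi} (\<lambda>\<theta>. a + exp (\<i> * complex_of_real \<theta>) *s b)"
      unfolding vector_scalar_mult_def by (intro continuous_intros continuous_on_vec_lambda)
  qed (use V(1) in auto)
  have fM: "f \<theta> \<le> M" for \<theta>
  proof -
    have l: "cmod (exp (\<i> * complex_of_real \<theta>)) \<le> 1" by simp
    let ?l = "exp (\<i> * complex_of_real \<theta>)"
    have "f \<theta> = u (G ?l)" using V(2)[OF l] by (simp add: f_def)
    also have "\<dots> \<le> max (v (ts + h * Re ?l)) (u (\<Gamma> (0, h * Im ?l)))"
      unfolding G_def v_def by (rule u\<Gamma>) (use inT[OF l] in auto)
    also have "\<dots> \<le> M" using tm(2)[of "ts + h * Re ?l"] inT[OF l] by (auto simp: M_def)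
    finally show ?thesis .
  qed
  have "(u \<circ> g) a \<le> integral {0..2*pi} f / (2*pi)"
    using pV V(1) unfolding psh_on_def f_def by blast
  then have "M \<le> integral {0..2*pi} f / (2*pi)" using g0 ts(2) by (simp add: v_def)
  then have int: "M * (2*pi) \<le> integral {0..2*pi} f" by (simp add: pos_le_divide_eq)
  have fi: "f integrable_on {0..2*pi}" using fc by (rule integrable_continuous_real)
  then have "integral {0..2*pi} (\<lambda>\<theta>. M - f \<theta>) = M * (2*pi) - integral {0..2*pi} f"
    by (subst Henstock_Kurzweil_Integration.integral_diff) (auto simp: mult.commute)
  moreover have "integral {0..2*pi} (\<lambda>\<theta>. M - f \<theta>) \<ge> 0"
    by (rule integral_nonneg) (use fi fM in \<open>auto intro!: integrable_diff\<close>)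
  ultimately have "integral {0..2*pi} (\<lambda>\<theta>. M - f \<theta>) = 0" using int by simp
  \<comment> \<open>A continuous nonnegative function with zero integral vanishes identically, so
    \<open>f = M\<close> on the whole circle; the angle \<open>pi\<close> then gives the point
    \<open>ts - h\<close>.\<close>
  then have "\<forall>\<theta>\<in>{0..2*pi}. M - f \<theta> = 0"
    by (subst (asm) integral_eq_0_iff) (use fc fM in \<open>auto intro!: continuous_intros\<close>)
  then have "f pi = M" using pi_ge_zero by auto
  moreover have "f pi = u (G (-1))"
    using V(2)[of "-1"] by (simp add: f_def exp_pi_i')
  ultimately have "v (ts - h) = M" by (simp add: G_def v_def)
  moreover have "0 \<le> ts - h" using inT(1)[of "-1"] by simp
  ultimately show False using before[of "ts - h"] h(1) by simp
qed

text \<open>On finite positive values \<open>- ln\<close> reverses the order, which turns the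
  maximum principle into a minimum principle. The case of infinite distance is split off because
  \<open>real_of_ereal\<close> sends \<infinity> to \<open>0\<close>, so the logarithm would carry
  no information there.\<close>

lemma pseudoconvex_bdist_minimum_principle:
  fixes P :: "'a \<Rightarrow> complex^'n"
  assumes lh: "local_homeo D P" and H: "Hausdorff_space D" and pc: "pseudoconvex D P" and e: "e > 0"
    and \<Gamma>: "continuous_map (top_of_set ({0..1} \<times> {-e<..<e})) D \<Gamma>"
    and P\<Gamma>: "\<And>t s. t \<in> {0..1} \<Longrightarrow> s \<in> {-e<..<e} \<Longrightarrow> P (\<Gamma> (t, s)) = \<alpha> + Complex t s *s \<beta>"
    and d\<Gamma>: "\<And>t s. t \<in> {0..1} \<Longrightarrow> s \<in> {-e<..<e} \<Longrightarrow>
      min (bdist D P (\<Gamma> (t, 0))) (bdist D P (\<Gamma> (0, s))) \<le> bdist D P (\<Gamma> (t, s))"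
    and t: "t \<in> {0..1}"
  shows "min (bdist D P (\<Gamma> (0, 0))) (bdist D P (\<Gamma> (1, 0))) \<le> bdist D P (\<Gamma> (t, 0))"
proof -
  have top: "\<Gamma> (t, s) \<in> topspace D" if "t \<in> {0..1}" "s \<in> {-e<..<e}" for t s
    using \<Gamma> that by (auto simp: continuous_map_def)
  show ?thesis
  proof (cases "\<forall>z\<in>topspace D. bdist D P z = \<infinity>")
    case True
    then show ?thesis using top[OF t, of 0] e by simp
  next
    case False
    let ?u = "\<lambda>z. - ln (real_of_ereal (bdist D P z))"
    have fin: "\<And>z. z \<in> topspace D \<Longrightarrow> bdist D P z < \<infinity>" and psh: "psh_on_domain D P ?u"
      using pc False by (auto simp: pseudoconvex_def)
    have le: "bdist D P z \<le> bdist D P w \<longleftrightarrow> ?u w \<le> ?u z"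
      if "z \<in> topspace D" "w \<in> topspace D" for z w
      using bdist_pos[OF lh H that(1)] bdist_pos[OF lh H that(2)] fin[OF that(1)] fin[OF that(2)]
      by (cases "bdist D P z"; cases "bdist D P w") auto
    have 0: "0 \<in> {-e<..<e}" using e by simp
    have "?u (\<Gamma> (t, 0)) \<le> max (?u (\<Gamma> (0, 0))) (?u (\<Gamma> (1, 0)))"
    proof (rule psh_maximum_principle[OF lh psh e \<Gamma> P\<Gamma> _ t])
      fix t s :: real assume ts: "t \<in> {0..1}" "s \<in> {-e<..<e}"
      show "?u (\<Gamma> (t, s)) \<le> max (?u (\<Gamma> (t, 0))) (?u (\<Gamma> (0, s)))"
        using d\<Gamma>[OF ts] le[OF top top] ts 0 by (simp add: min_le_iff_disj le_max_iff_disj)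
    qed
    then show ?thesis
      using le[OF top top] t 0 by (simp add: min_le_iff_disj le_max_iff_disj)
  qed
qed

text \<open>Supplies the uniform radii for lifting segments. By continuity
  \<open>- ln \<delta>\<close> grows by less than \<open>1\<close> near \<open>z\<close>, so
  \<open>\<epsilon>\<close> is \<open>\<delta>(z)\<close> divided by \<open>exp 1\<close>; if the
  distance is infinite everywhere, any positive constant serves.\<close>

lemma pseudoconvex_bdist_locally_bounded_below:
  fixes P :: "'a \<Rightarrow> complex^'n"
  assumes lh: "local_homeo D P" and H: "Hausdorff_space D" and pc: "pseudoconvex D P"
    and z: "z \<in> topspace D"
  obtains N \<epsilon> where "openin D N" "z \<in> N" "\<epsilon> > 0" "\<And>w. w \<in> N \<Longrightarrow> ereal \<epsilon> < bdist D P w"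
proof (cases "\<forall>z\<in>topspace D. bdist D P z = \<infinity>")
  case True
  then show ?thesis using that[of "topspace D" 1] z by simp
next
  case False
  let ?u = "\<lambda>z. - ln (real_of_ereal (bdist D P z))"
  have fin: "\<And>z. z \<in> topspace D \<Longrightarrow> bdist D P z < \<infinity>" and uc: "continuous_map D euclideanreal ?u"
    using pc False by (auto simp: pseudoconvex_def psh_on_domain_def)
  let ?c = "?u z + 1"
  let ?N = "{w \<in> topspace D. ?u w \<in> {..<?c}}"
  have "openin D ?N"
    by (rule openin_continuous_map_preimage[OF uc]) simp
  moreover have "z \<in> ?N" using z by simp
  moreover have "ereal (exp (- ?c)) < bdist D P w" if w: "w \<in> ?N" for w
  proof -
    obtain r where r: "bdist D P w = ereal r" "r > 0"
      using bdist_pos[OF lh H, of w] fin[of w] w by (cases "bdist D P w") auto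
    then have "- ?c < ln r" using w by simp
    then have "exp (- ?c) < r" using r(2) by (metis exp_less_cancel_iff exp_ln)
    then show ?thesis using r by simp
  qed
  ultimately show ?thesis using that[of ?N "exp (- ?c)"] by simp
qed

section \<open>Generalized tubes\<close>

definition vec_Complex :: "real^'n \<Rightarrow> real^'n \<Rightarrow> complex^'n" where
  "vec_Complex a b = (\<chi> i. Complex (a $ i) (b $ i))"

definition vec_Re :: "complex^'n \<Rightarrow> real^'n" where
  "vec_Re z = (\<chi> i. Re (z $ i))"

definition vec_Im :: "complex^'n \<Rightarrow> real^'n" where
  "vec_Im z = (\<chi> i. Im (z $ i))"

lemma vec_Re_Im_simps [simp]:
  "vec_Re (vec_Complex a b) = a" "vec_Im (vec_Complex a b) = b"
  "vec_Complex (vec_Re z) (vec_Im z) = z"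
  by (simp_all add: vec_Complex_def vec_Re_def vec_Im_def vec_eq_iff)

lemma tube_proj_Pair: "tube_proj p1 p2 (x, y) = vec_Complex (p1 x) (p2 y)"
  by (simp add: tube_proj_def vec_Complex_def)

lemma vec_Re_Im_tube_proj [simp]:
  "vec_Re (tube_proj p1 p2 w) = p1 (fst w)" "vec_Im (tube_proj p1 p2 w) = p2 (snd w)"
  by (cases w; simp add: tube_proj_Pair)+

lemma continuous_on_vec_Re [continuous_intros]:
  "continuous_on S f \<Longrightarrow> continuous_on S (\<lambda>x. vec_Re (f x))"
  unfolding vec_Re_def by (intro continuous_intros continuous_on_vec_lambda)

lemma continuous_on_vec_Im [continuous_intros]:
  "continuous_on S f \<Longrightarrow> continuous_on S (\<lambda>x. vec_Im (f x))"
  unfolding vec_Im_def by (intro continuous_intros continuous_on_vec_lambda)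

lemma continuous_on_vec_Complex [continuous_intros]:
  "continuous_on S f \<Longrightarrow> continuous_on S g \<Longrightarrow> continuous_on S (\<lambda>x. vec_Complex (f x) (g x))"
  unfolding vec_Complex_def Complex_eq
  by (intro continuous_intros continuous_on_vec_lambda)

text \<open>This bound and the next send a complex ball into real balls of the same radius, so that
  sections of the two factors can be paired over it. The isometries that follow embed a real ball as
  a slice of the complex ball and serve the converse direction. Radii therefore pass unchanged
  between the tube and its factors.\<close>

lemma dist_vec_Re_le: "dist (vec_Re z) (vec_Re w) \<le> dist z w"
  unfolding dist_vec_def vec_Re_def
  by (rule L2_set_mono) (auto simp: dist_norm simp flip: minus_complex.sel intro: abs_Re_le_cmod)

lemma dist_vec_Im_le: "dist (vec_Im z) (vec_Im w) \<le> dist z w"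
  unfolding dist_vec_def vec_Im_def
  by (rule L2_set_mono) (auto simp: dist_norm simp flip: minus_complex.sel intro: abs_Im_le_cmod)

lemma dist_vec_Complex_left: "dist (vec_Complex a b) (vec_Complex a' b) = dist a a'"
  unfolding dist_vec_def vec_Complex_def
  by (rule L2_set_cong) (auto simp: dist_norm complex_diff cmod_def)

lemma dist_vec_Complex_right: "dist (vec_Complex a b) (vec_Complex a b') = dist b b'"
  unfolding dist_vec_def vec_Complex_def
  by (rule L2_set_cong) (auto simp: dist_norm complex_diff cmod_def)

section \<open>Charts, sections and boundary distance of the tube\<close>

lemma local_homeo_tube_proj:
  fixes p1 :: "'a \<Rightarrow> real^'n" and p2 :: "'b \<Rightarrow> real^'n"
  assumes "local_homeo A1 p1" "local_homeo A2 p2"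
  shows "local_homeo (prod_topology A1 A2) (tube_proj p1 p2)"
  unfolding local_homeo_def
proof
  fix z assume z: "z \<in> topspace (prod_topology A1 A2)"
  then have z1: "fst z \<in> topspace A1" and z2: "snd z \<in> topspace A2" by auto
  obtain U1 V1 g1 where c1: "openin A1 U1" "fst z \<in> U1" "open V1"
    "homeomorphic_maps (subtopology A1 U1) (top_of_set V1) p1 g1"
    using local_homeo_chart[OF assms(1) z1] .
  obtain U2 V2 g2 where c2: "openin A2 U2" "snd z \<in> U2" "open V2"
    "homeomorphic_maps (subtopology A2 U2) (top_of_set V2) p2 g2"
    using local_homeo_chart[OF assms(2) z2] .
  note m1 = chart_maps[OF c1(4,1,3)] and m2 = chart_maps[OF c2(4,1,3)]
  let ?V = "vec_Re -` V1 \<inter> vec_Im -` V2 :: (complex^'n) set"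
  let ?D = "subtopology (prod_topology A1 A2) (U1 \<times> U2)"
  have "open ?V"
    using c1(3) c2(3) by (intro open_Int open_vimage continuous_intros) auto
  moreover have "homeomorphic_maps ?D (top_of_set ?V) (tube_proj p1 p2)
      (\<lambda>z. (g1 (vec_Re z), g2 (vec_Im z)))"
    unfolding homeomorphic_maps_def
  proof (intro conjI)
    have "continuous_map ?D euclidean (p1 \<circ> fst)"
      unfolding subtopology_Times by (rule continuous_map_compose[OF continuous_map_fst m1(5)])
    moreover have "continuous_map ?D euclidean (p2 \<circ> snd)"
      unfolding subtopology_Times by (rule continuous_map_compose[OF continuous_map_snd m2(5)])
    ultimately have "continuous_map ?D (prod_topology euclidean euclidean) (\<lambda>w. (p1 (fst w), p2 (snd w)))"
      unfolding o_def by (rule continuous_map_pairedI)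
    moreover have "continuous_map (prod_topology euclidean euclidean) euclidean
        (\<lambda>(a::real^'n, b). vec_Complex a b)"
      by (auto simp: case_prod_unfold euclidean_product_topology intro!: continuous_intros)
    ultimately have "continuous_map ?D euclidean ((\<lambda>(a, b). vec_Complex a b) \<circ> (\<lambda>w. (p1 (fst w), p2 (snd w))))"
      by (rule continuous_map_compose)
    also have "(\<lambda>(a, b). vec_Complex a b) \<circ> (\<lambda>w. (p1 (fst w), p2 (snd w))) = tube_proj p1 p2"
      by (auto simp: tube_proj_Pair)
    finally show "continuous_map ?D (top_of_set ?V) (tube_proj p1 p2)"
      using m1(1) m2(1) by (auto intro!: continuous_map_into_subtopology)
    have "continuous_map (top_of_set ?V) (top_of_set V1) vec_Re"
      "continuous_map (top_of_set ?V) (top_of_set V2) vec_Im"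
      by (auto intro!: continuous_map_into_subtopology continuous_intros)
    then have "continuous_map (top_of_set ?V) A1 (g1 \<circ> vec_Re)" 
      "continuous_map (top_of_set ?V) A2 (g2 \<circ> vec_Im)"
      using m1(6) m2(6) continuous_map_compose by blast+
    then show "continuous_map (top_of_set ?V) ?D (\<lambda>z. (g1 (vec_Re z), g2 (vec_Im z)))"
      using m1(3) m2(3) by (auto simp: o_def intro!: continuous_map_into_subtopology continuous_map_pairedI)
  qed (use m1 m2 in \<open>auto simp: tube_proj_Pair\<close>)
  then have "homeomorphic_map ?D (top_of_set ?V) (tube_proj p1 p2)"
    unfolding homeomorphic_map_maps by blast
  moreover have "openin (prod_topology A1 A2) (U1 \<times> U2)" "z \<in> U1 \<times> U2"
    using c1 c2 by (auto simp: openin_prod_Times_iff mem_Times_iff)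
  ultimately show "\<exists>U V. openin (prod_topology A1 A2) U \<and> z \<in> U \<and> open V \<and>
      homeomorphic_map (subtopology (prod_topology A1 A2) U) (top_of_set V) (tube_proj p1 p2)"
    by blast
qed

text \<open>The real ball sits in the complex ball as the slice with imaginary part
  \<open>p2 y\<close>; the section is restricted to this slice and followed by the projection to
  \<open>A1\<close>.\<close>

lemma ball_section_tube_fst:
  assumes "ball_section (prod_topology A1 A2) (tube_proj p1 p2) (x, y) r \<sigma>"
  shows "ball_section A1 p1 x r (\<lambda>a. fst (\<sigma> (vec_Complex a (p2 y))))"
proof -
  let ?B = "ball (tube_proj p1 p2 (x, y)) r"
  have s: "continuous_map (top_of_set ?B) (prod_topology A1 A2) \<sigma>"
    "\<And>a. a \<in> ?B \<Longrightarrow> tube_proj p1 p2 (\<sigma> a) = a" "\<sigma> (tube_proj p1 p2 (x, y)) = (x, y)"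
    using assms by (auto simp: ball_section_def)
  have B: "vec_Complex a (p2 y) \<in> ?B" if "a \<in> ball (p1 x) r" for a
    using that by (simp add: tube_proj_Pair dist_vec_Complex_left)
  have "continuous_map (top_of_set (ball (p1 x) r)) (top_of_set ?B) (\<lambda>a. vec_Complex a (p2 y))"
    using B by (auto intro!: continuous_map_into_subtopology continuous_intros)
  from continuous_map_compose[OF continuous_map_compose[OF this s(1)] continuous_map_fst]
  have "continuous_map (top_of_set (ball (p1 x) r)) A1 (\<lambda>a. fst (\<sigma> (vec_Complex a (p2 y))))"
    by (simp add: o_def)
  moreover have "p1 (fst (\<sigma> (vec_Complex a (p2 y)))) = a" if "a \<in> ball (p1 x) r" for a
    using arg_cong[OF s(2)[OF B[OF that]], of vec_Re] by simp
  ultimately show ?thesis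
    using s(3) by (simp add: ball_section_def tube_proj_Pair)
qed

lemma ball_section_tube_snd:
  assumes "ball_section (prod_topology A1 A2) (tube_proj p1 p2) (x, y) r \<sigma>"
  shows "ball_section A2 p2 y r (\<lambda>b. snd (\<sigma> (vec_Complex (p1 x) b)))"
proof -
  let ?B = "ball (tube_proj p1 p2 (x, y)) r"
  have s: "continuous_map (top_of_set ?B) (prod_topology A1 A2) \<sigma>"
    "\<And>a. a \<in> ?B \<Longrightarrow> tube_proj p1 p2 (\<sigma> a) = a" "\<sigma> (tube_proj p1 p2 (x, y)) = (x, y)"
    using assms by (auto simp: ball_section_def)
  have B: "vec_Complex (p1 x) b \<in> ?B" if "b \<in> ball (p2 y) r" for b
    using that by (simp add: tube_proj_Pair dist_vec_Complex_right)
  have "continuous_map (top_of_set (ball (p2 y) r)) (top_of_set ?B) (\<lambda>b. vec_Complex (p1 x) b)"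
    using B by (auto intro!: continuous_map_into_subtopology continuous_intros)
  from continuous_map_compose[OF continuous_map_compose[OF this s(1)] continuous_map_snd]
  have "continuous_map (top_of_set (ball (p2 y) r)) A2 (\<lambda>b. snd (\<sigma> (vec_Complex (p1 x) b)))"
    by (simp add: o_def)
  moreover have "p2 (snd (\<sigma> (vec_Complex (p1 x) b))) = b" if "b \<in> ball (p2 y) r" for b
    using arg_cong[OF s(2)[OF B[OF that]], of vec_Im] by simp
  ultimately show ?thesis
    using s(3) by (simp add: ball_section_def tube_proj_Pair)
qed

lemma ball_section_tube_Pair:
  assumes "ball_section A1 p1 x r \<sigma>1" "ball_section A2 p2 y r \<sigma>2"
  shows "ball_section (prod_topology A1 A2) (tube_proj p1 p2) (x, y) r
    (\<lambda>z. (\<sigma>1 (vec_Re z), \<sigma>2 (vec_Im z)))"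
proof -
  let ?B = "ball (tube_proj p1 p2 (x, y)) r"
  have B: "vec_Re z \<in> ball (p1 x) r" "vec_Im z \<in> ball (p2 y) r" if "z \<in> ?B" for z
    using that dist_vec_Re_le[of "tube_proj p1 p2 (x, y)" z]
      dist_vec_Im_le[of "tube_proj p1 p2 (x, y)" z] by auto
  have "continuous_map (top_of_set ?B) (top_of_set (ball (p1 x) r)) vec_Re"
    "continuous_map (top_of_set ?B) (top_of_set (ball (p2 y) r)) vec_Im"
    using B by (auto intro!: continuous_map_into_subtopology continuous_intros)
  then have "continuous_map (top_of_set ?B) A1 (\<sigma>1 \<circ> vec_Re)"
    "continuous_map (top_of_set ?B) A2 (\<sigma>2 \<circ> vec_Im)"
    using assms continuous_map_compose unfolding ball_section_def by blast+
  then have "continuous_map (top_of_set ?B) (prod_topology A1 A2) (\<lambda>z. (\<sigma>1 (vec_Re z), \<sigma>2 (vec_Im z)))"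
    unfolding o_def by (rule continuous_map_pairedI)
  moreover have "tube_proj p1 p2 (\<sigma>1 (vec_Re z), \<sigma>2 (vec_Im z)) = z" if "z \<in> ?B" for z
  proof -
    have "p1 (\<sigma>1 (vec_Re z)) = vec_Re z" "p2 (\<sigma>2 (vec_Im z)) = vec_Im z"
      using assms B[OF that] unfolding ball_section_def by blast+
    then show ?thesis by (simp add: tube_proj_Pair)
  qed
  ultimately show ?thesis
    using assms unfolding ball_section_def by (simp add: tube_proj_Pair)
qed

text \<open>Formulated within the tube, since \<open>bdist\<close> is defined for maps into
  \<open>complex^'n\<close>. The point \<open>(x, y0)\<close> contributes a section of
  \<open>A1\<close> about \<open>x\<close>, the point \<open>(x0, y)\<close> a section of
  \<open>A2\<close> about \<open>y\<close>, and these pair to a section about \<open>(x, y)\<close>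
  of the same radius.\<close>

lemma bdist_tube_ge_min:
  assumes "local_homeo A1 p1" "local_homeo A2 p2" "Hausdorff_space A1" "Hausdorff_space A2"
    and "x \<in> topspace A1" "x0 \<in> topspace A1" "y \<in> topspace A2" "y0 \<in> topspace A2"
  defines "d \<equiv> bdist (prod_topology A1 A2) (tube_proj p1 p2)"
  shows "min (d (x, y0)) (d (x0, y)) \<le> d (x, y)"
proof (rule ccontr)
  let ?D = "prod_topology A1 A2"
  have lh: "local_homeo ?D (tube_proj p1 p2)" and H: "Hausdorff_space ?D"
    using assms by (auto intro: local_homeo_tube_proj simp: Hausdorff_space_prod_topology)
  assume "\<not> ?thesis"
  \<comment> \<open>A real radius strictly between the two sides, so that sections of radius
    \<open>r\<close> exist at both comparison points even if the distances there are
    infinite.\<close>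
  then obtain r where r: "d (x, y) < ereal r" "ereal r < d (x, y0)" "ereal r < d (x0, y)"
    using ereal_dense2[of "d (x, y)" "min (d (x, y0)) (d (x0, y))"] by (auto simp: not_le)
  have "0 < d (x, y)" unfolding d_def using assms by (intro bdist_pos[OF lh H]) auto
  then have "0 < r" using r(1) by (metis ereal_less(2) less_trans)
  obtain \<sigma> where \<sigma>: "ball_section ?D (tube_proj p1 p2) (x, y0) r \<sigma>"
    using ball_section_less_bdist[OF lh H, of "(x, y0)" r] r assms by auto
  obtain \<sigma>' where \<sigma>': "ball_section ?D (tube_proj p1 p2) (x0, y) r \<sigma>'"
    using ball_section_less_bdist[OF lh H, of "(x0, y)" r] r assms by auto
  have "\<exists>\<tau>. ball_section ?D (tube_proj p1 p2) (x, y) r \<tau>"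
    using ball_section_tube_Pair[OF ball_section_tube_fst[OF \<sigma>] ball_section_tube_snd[OF \<sigma>']] by blast
  then have "ereal r \<le> d (x, y)"
    unfolding d_def using assms \<open>0 < r\<close>
    by (subst bdist_eq_Sup_ball_section[OF lh H]) (auto intro!: Sup_upper)
  then show False using r(1) by simp
qed

text \<open>Provides the second real direction when a segment in one factor is complexified: a short
  lifted line through the base point of the other factor.\<close>

lemma lifted_line_germ:
  fixes p :: "'a \<Rightarrow> 'b::real_normed_vector"
  assumes "local_homeo X p" "y \<in> topspace X"
  obtains e \<eta> where "e > 0" "continuous_map (top_of_set {-e<..<e}) X \<eta>" "\<eta> 0 = y"
    "\<And>s. s \<in> {-e<..<e} \<Longrightarrow> p (\<eta> s) = p y + s *\<^sub>R v"
proof -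
  obtain r \<sigma> where r: "r > 0" and \<sigma>: "ball_section X p y r \<sigma>"
    using ball_section_exists[OF assms] .
  \<comment> \<open>The summand \<open>1\<close> keeps the denominator positive when
    \<open>v = 0\<close>.\<close>
  define e where "e = r / (norm v + 1)"
  have nv: "norm v + 1 > 0" by (simp add: add_nonneg_pos)
  then have "e > 0" using r by (simp add: e_def)
  have B: "p y + s *\<^sub>R v \<in> ball (p y) r" if "s \<in> {-e<..<e}" for s
  proof -
    have "norm (s *\<^sub>R v) \<le> \<bar>s\<bar> * (norm v + 1)" by (simp add: mult_left_mono)
    also have "\<dots> < e * (norm v + 1)" using that nv by (intro mult_strict_right_mono) auto
    also have "\<dots> = r" using nv by (simp add: e_def)
    finally show ?thesis by (simp add: dist_norm)
  qed
  have "continuous_map (top_of_set {-e<..<e}) (top_of_set (ball (p y) r)) (\<lambda>s. p y + s *\<^sub>R v)"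
    using B by (auto intro!: continuous_map_into_subtopology continuous_intros)
  then have "continuous_map (top_of_set {-e<..<e}) X (\<sigma> \<circ> (\<lambda>s. p y + s *\<^sub>R v))"
    using \<sigma> continuous_map_compose unfolding ball_section_def by blast
  then show ?thesis
    using that[of e "\<sigma> \<circ> (\<lambda>s. p y + s *\<^sub>R v)"] \<open>e > 0\<close> \<sigma> B by (auto simp: ball_section_def)
qed

lemma continuous_map_fst_snd_top_of_set:
  assumes "continuous_map (top_of_set S) X f" "continuous_map (top_of_set T) Y g"
  shows "continuous_map (top_of_set (S \<times> T)) X (\<lambda>w. f (fst w))"
    "continuous_map (top_of_set (S \<times> T)) Y (\<lambda>w. g (snd w))"
proof -
  have c: "continuous_map (top_of_set (S \<times> T)) (top_of_set S) fst"
    "continuous_map (top_of_set (S \<times> T)) (top_of_set T) snd"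
    by (auto intro!: continuous_map_into_subtopology continuous_intros)
  show "continuous_map (top_of_set (S \<times> T)) X (\<lambda>w. f (fst w))"
    "continuous_map (top_of_set (S \<times> T)) Y (\<lambda>w. g (snd w))"
    using continuous_map_compose[OF c(1) assms(1)] continuous_map_compose[OF c(2) assms(2)]
    by (simp_all add: o_def)
qed

lemma open_image_local_homeo:
  fixes p :: "'a \<Rightarrow> 'b::topological_space"
  assumes "local_homeo X p"
  shows "open (p ` topspace X)"
proof (subst open_subopen, intro ballI)
  fix a assume "a \<in> p ` topspace X"
  then obtain x where x: "x \<in> topspace X" "a = p x" by blast
  obtain U V g where c: "openin X U" "x \<in> U" "open V"
    "homeomorphic_maps (subtopology X U) (top_of_set V) p g"
    using local_homeo_chart[OF assms x(1)] .
  note m = chart_maps[OF c(4,1,3)]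
  have "V \<subseteq> p ` topspace X"
    using m(3,4) openin_subset[OF c(1)] by (metis image_eqI subsetD subsetI)
  then show "\<exists>T. open T \<and> a \<in> T \<and> T \<subseteq> p ` topspace X" using c m(1) x by blast
qed

section \<open>Complexified segments in the two factors\<close>

theorem theorem1p2:
  fixes A1 :: "'a topology" and A2 :: "'b topology"
    and p1 :: "'a \<Rightarrow> real^'n" and p2 :: "'b \<Rightarrow> real^'n"
  assumes "domain_over A1 p1" and "domain_over A2 p2"
    and "pseudoconvex (prod_topology A1 A2) (tube_proj p1 p2)"
  shows "inj_on p1 (topspace A1) \<and> inj_on p2 (topspace A2)
    \<and> open (p1 ` topspace A1) \<and> connected (p1 ` topspace A1) \<and> convex (p1 ` topspace A1)
    \<and> open (p2 ` topspace A2) \<and> connected (p2 ` topspace A2) \<and> convex (p2 ` topspace A2)"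
proof -
  let ?D = "prod_topology A1 A2" and ?P = "tube_proj p1 p2"
  let ?d = "bdist ?D ?P"
  have lh1: "local_homeo A1 p1" and H1: "Hausdorff_space A1"
    and lh2: "local_homeo A2 p2" and H2: "Hausdorff_space A2"
    using assms(1,2) by (auto simp: domain_over_def)
  have lh: "local_homeo ?D ?P" and H: "Hausdorff_space ?D"
    using lh1 lh2 H1 H2 by (auto intro: local_homeo_tube_proj simp: Hausdorff_space_prod_topology)
  note pc = assms(3)
  note dmin = bdist_tube_ge_min[OF lh1 lh2 H1 H2]
  obtain x0 y0 where x0: "x0 \<in> topspace A1" and y0: "y0 \<in> topspace A2"
    using assms(1,2) unfolding domain_over_def by blast
  \<comment> \<open>The boundary distance of the tube along the slice \<open>y = y0\<close> stands
    in for a boundary distance on \<open>A1\<close>.\<close>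
  have seg1: "\<exists>\<gamma>. lifted_segment A1 p1 x x' \<gamma>" if "x \<in> topspace A1" "x' \<in> topspace A1" for x x'
  proof (rule lifted_segment_exists[OF assms(1), where d = "\<lambda>x. ?d (x, y0)", OF _ _ _ that])
    fix x assume x: "x \<in> topspace A1"
    show "\<exists>\<sigma>. ball_section A1 p1 x r \<sigma>" if "ereal r < ?d (x, y0)" for r
      using ball_section_less_bdist[OF lh H, of "(x, y0)" r] that x y0 ball_section_tube_fst
      by (metis mem_Sigma_iff topspace_prod_topology)
    obtain N \<epsilon> where N: "openin ?D N" "(x, y0) \<in> N" "\<epsilon> > 0" "\<And>w. w \<in> N \<Longrightarrow> ereal \<epsilon> < ?d w"
      using pseudoconvex_bdist_locally_bounded_below[OF lh H pc, of "(x, y0)"] x y0 by auto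
    have "continuous_map A1 ?D (\<lambda>x. (x, y0))" using y0 by (auto intro!: continuous_map_pairedI)
    then have "openin A1 {x \<in> topspace A1. (x, y0) \<in> N}"
      using N(1) by (rule openin_continuous_map_preimage)
    then show "\<exists>N \<epsilon>. openin A1 N \<and> x \<in> N \<and> 0 < \<epsilon> \<and> (\<forall>w\<in>N. ereal \<epsilon> < ?d (w, y0))"
      using N x by (intro exI[of _ "{x \<in> topspace A1. (x, y0) \<in> N}"] exI[of _ \<epsilon>]) auto
  next
    fix x x' \<gamma> and t :: real
    assume \<gamma>: "lifted_segment A1 p1 x x' \<gamma>" and t: "t \<in> {0..1}"
    define v where "v = p1 x' - p1 x"
    \<comment> \<open>Moving the second factor in the same direction \<open>v\<close> places
      \<open>(\<gamma> t, \<eta> s)\<close> over the point with parameter \<open>Complex t s\<close>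
      of a complex line with direction \<open>vec_Complex v 0\<close>.\<close>
    obtain e \<eta> where e: "e > 0" and \<eta>: "continuous_map (top_of_set {-e<..<e}) A2 \<eta>" "\<eta> 0 = y0"
      "\<And>s. s \<in> {-e<..<e} \<Longrightarrow> p2 (\<eta> s) = p2 y0 + s *\<^sub>R v"
      using lifted_line_germ[OF lh2 y0, of v] by blast
    have \<gamma>c: "continuous_map (top_of_set {0..1}) A1 \<gamma>" using \<gamma> by (simp add: lifted_segment_def)
    have top: "\<gamma> t \<in> topspace A1" "\<eta> s \<in> topspace A2" if "t \<in> {0..1}" "s \<in> {-e<..<e}" for t s
      using \<gamma>c \<eta>(1) that by (auto simp: continuous_map_def)
    define \<Gamma> where "\<Gamma> w = (\<gamma> (fst w), \<eta> (snd w))" for w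
    have "min (?d (\<Gamma> (0, 0))) (?d (\<Gamma> (1, 0))) \<le> ?d (\<Gamma> (t, 0))"
    proof (rule pseudoconvex_bdist_minimum_principle[OF lh H pc e _ _ _ t])
      show "continuous_map (top_of_set ({0..1} \<times> {-e<..<e})) ?D \<Gamma>"
        unfolding \<Gamma>_def using continuous_map_fst_snd_top_of_set[OF \<gamma>c \<eta>(1)]
        by (intro continuous_map_pairedI)
      fix t s :: real assume ts: "t \<in> {0..1}" "s \<in> {-e<..<e}"
      have "p1 (\<gamma> t) = p1 x + t *\<^sub>R v" using \<gamma> ts by (simp add: lifted_segment_def v_def)
      then show "?P (\<Gamma> (t, s)) = vec_Complex (p1 x) (p2 y0) + Complex t s *s vec_Complex v 0"
        using \<eta>(3)[OF ts(2)]
        by (simp add: \<Gamma>_def tube_proj_Pair vec_Complex_def vec_eq_iff complex_eq_iff)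
      \<comment> \<open>The comparison points are \<open>\<gamma> 0\<close> and
        \<open>\<eta> 0\<close>, so both terms of the minimum lie on the axes \<open>s = 0\<close>
        and \<open>t = 0\<close> of the strip.\<close>
      show "min (?d (\<Gamma> (t, 0))) (?d (\<Gamma> (0, s))) \<le> ?d (\<Gamma> (t, s))"
        unfolding \<Gamma>_def fst_conv snd_conv using ts e by (intro dmin top) auto
    qed
    then show "min (?d (x, y0)) (?d (x', y0)) \<le> ?d (\<gamma> t, y0)"
      using \<gamma> \<eta>(2) by (simp add: \<Gamma>_def lifted_segment_def)
  qed
  have seg2: "\<exists>\<gamma>. lifted_segment A2 p2 y y' \<gamma>" if "y \<in> topspace A2" "y' \<in> topspace A2" for y y'
  proof (rule lifted_segment_exists[OF assms(2), where d = "\<lambda>y. ?d (x0, y)", OF _ _ _ that])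
    fix y assume y: "y \<in> topspace A2"
    show "\<exists>\<sigma>. ball_section A2 p2 y r \<sigma>" if "ereal r < ?d (x0, y)" for r
      using ball_section_less_bdist[OF lh H, of "(x0, y)" r] that y x0 ball_section_tube_snd
      by (metis mem_Sigma_iff topspace_prod_topology)
    obtain N \<epsilon> where N: "openin ?D N" "(x0, y) \<in> N" "\<epsilon> > 0" "\<And>w. w \<in> N \<Longrightarrow> ereal \<epsilon> < ?d w"
      using pseudoconvex_bdist_locally_bounded_below[OF lh H pc, of "(x0, y)"] y x0 by auto
    have "continuous_map A2 ?D (\<lambda>y. (x0, y))" using x0 by (auto intro!: continuous_map_pairedI)
    then have "openin A2 {y \<in> topspace A2. (x0, y) \<in> N}"
      using N(1) by (rule openin_continuous_map_preimage)
    then show "\<exists>N \<epsilon>. openin A2 N \<and> y \<in> N \<and> 0 < \<epsilon> \<and> (\<forall>w\<in>N. ereal \<epsilon> < ?d (x0, w))"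
      using N y by (intro exI[of _ "{y \<in> topspace A2. (x0, y) \<in> N}"] exI[of _ \<epsilon>]) auto
  next
    fix y y' \<gamma> and t :: real
    assume \<gamma>: "lifted_segment A2 p2 y y' \<gamma>" and t: "t \<in> {0..1}"
    define v where "v = p2 y' - p2 y"
    \<comment> \<open>The segment now runs in the imaginary direction. Since
      \<open>(t + i s) (i v) = - s v + i t v\<close>, the first factor has to move along
      \<open>- v\<close>.\<close>
    obtain e \<eta> where e: "e > 0" and \<eta>: "continuous_map (top_of_set {-e<..<e}) A1 \<eta>" "\<eta> 0 = x0"
      "\<And>s. s \<in> {-e<..<e} \<Longrightarrow> p1 (\<eta> s) = p1 x0 + s *\<^sub>R (- v)"
      using lifted_line_germ[OF lh1 x0, of "- v"] by blast
    have \<gamma>c: "continuous_map (top_of_set {0..1}) A2 \<gamma>" using \<gamma> by (simp add: lifted_segment_def)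
    have top: "\<gamma> t \<in> topspace A2" "\<eta> s \<in> topspace A1" if "t \<in> {0..1}" "s \<in> {-e<..<e}" for t s
      using \<gamma>c \<eta>(1) that by (auto simp: continuous_map_def)
    define \<Gamma> where "\<Gamma> w = (\<eta> (snd w), \<gamma> (fst w))" for w
    have "min (?d (\<Gamma> (0, 0))) (?d (\<Gamma> (1, 0))) \<le> ?d (\<Gamma> (t, 0))"
    proof (rule pseudoconvex_bdist_minimum_principle[OF lh H pc e _ _ _ t])
      show "continuous_map (top_of_set ({0..1} \<times> {-e<..<e})) ?D \<Gamma>"
        unfolding \<Gamma>_def using continuous_map_fst_snd_top_of_set[OF \<gamma>c \<eta>(1)]
        by (intro continuous_map_pairedI)
      fix t s :: real assume ts: "t \<in> {0..1}" "s \<in> {-e<..<e}"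
      have "p2 (\<gamma> t) = p2 y + t *\<^sub>R v" using \<gamma> ts by (simp add: lifted_segment_def v_def)
      then show "?P (\<Gamma> (t, s)) = vec_Complex (p1 x0) (p2 y) + Complex t s *s vec_Complex 0 v"
        using \<eta>(3)[OF ts(2)]
        by (simp add: \<Gamma>_def tube_proj_Pair vec_Complex_def vec_eq_iff complex_eq_iff)
      have "min (?d (\<eta> s, \<gamma> 0)) (?d (\<eta> 0, \<gamma> t)) \<le> ?d (\<eta> s, \<gamma> t)"
        using ts e by (intro dmin top) auto
      then show "min (?d (\<Gamma> (t, 0))) (?d (\<Gamma> (0, s))) \<le> ?d (\<Gamma> (t, s))"
        by (simp add: \<Gamma>_def min.commute)
    qed
    then show "min (?d (x0, y)) (?d (x0, y')) \<le> ?d (x0, \<gamma> t)"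
      using \<gamma> \<eta>(2) by (simp add: \<Gamma>_def lifted_segment_def)
  qed
  note ic1 = inj_on_convex_if_lifted_segments[OF lh1 H1 seg1]
  note ic2 = inj_on_convex_if_lifted_segments[OF lh2 H2 seg2]
  show ?thesis
    using ic1 ic2 open_image_local_homeo[OF lh1] open_image_local_homeo[OF lh2]
    by (simp add: convex_connected)
qed

end
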